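(* Assume that $A\in\mathbb C^{n\times n}$ is $\beta$-banded, i.e., $[A]_{ij}=0$ whenever $|i-j|>\beta$, and that $f$ is a scalar function such that $f(A)$ is defined and has exponential decay, i.e., there are constants $C>0$ and $0\le q<1$ such that $|[f(A)]_{ij}|\le C\,q^{\mathrm d(i,j)}$ for all $i,j\in\{1,\dots,n\}$. Let $d$ be a positive integer, let $\mathrm{col}(i)=(i-1)\bmod(d\beta+1)+1$ for $i=1,\dots,n$, let $V_\ell=\{i:\mathrm{col}(i)=\ell\}$ and $v_\ell=\sum_{i\in V_\ell}e_i$ for $\ell=1,\dots,m:=d\beta+1$, and let $$\mathcal T(f(A))=\sum_{\ell=1}^m v_\ell^Hf(A)v_\ell .$$ Put $\varepsilon=Cq^d$. Then $$|\mathrm{tr}(f(A))-\mathcal T(f(A))|\le\varepsilon\,\frac{2n}{1-q^d}.$$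
   Context: The directed graph $G(A)$ of $A$ has vertices $\{1,\dots,n\}$ and edges $\{(i,j): a_{ij}\ne0,\ i\ne j\}$; $\mathrm d(i,j)$ is the length of a shortest path from $i$ to $j$ in $G(A)$, $\infty$ if there is none, and $q^\infty:=0$. $e_i$ is the $i$th canonical unit vector. $f(A)$ is the usual matrix function (polynomial in $A$ interpolating $f$ on the spectrum of $A$ in the Hermite sense). *)

theory Defs
  imports
    Complex_Main
    "HOL-Library.Extended_Nat"
    "HOL-Computational_Algebra.Polynomial"
    "Graph_Theory.Arc_Walk"
    "Jordan_Normal_Form.Jordan_Normal_Form"
    "Jordan_Normal_Form.Conjugate"
begin

text \<open>
  Rows, columns, graph vertices and colours are numbered from 0 (the convention of the matrix
  library), so index \<open>i\<close> here is index \<open>i + 1\<close> of the 1-based notation;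
  differences of indices are unaffected.
\<close>

section \<open>The graph of a matrix\<close>

definition mat_graph :: "'a :: zero mat \<Rightarrow> (nat, nat \<times> nat) pre_digraph" where
  "mat_graph A =
    \<lparr> verts = {..<dim_row A},
      arcs = {(i, j). i < dim_row A \<and> j < dim_row A \<and> A $$ (i, j) \<noteq> 0 \<and> i \<noteq> j},
      tail = fst, head = snd \<rparr>"

text \<open>The infimum of the empty set in \<^typ>\<open>enat\<close> is \<open>\<infinity>\<close>.\<close>

definition mat_graph_dist :: "'a :: zero mat \<Rightarrow> nat \<Rightarrow> nat \<Rightarrow> enat" where
  "mat_graph_dist A i j = (INF p \<in> {p. pre_digraph.apath (mat_graph A) i p j}. enat (length p))"

definition pow_enat :: "real \<Rightarrow> enat \<Rightarrow> real" where
  "pow_enat q k = (case k of enat m \<Rightarrow> q ^ m | \<infinity> \<Rightarrow> 0)"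

definition banded :: "nat \<Rightarrow> 'a :: zero mat \<Rightarrow> bool" where
  "banded \<beta> A \<longleftrightarrow>
    (\<forall>i < dim_row A. \<forall>j < dim_col A. \<bar>int i - int j\<bar> > int \<beta> \<longrightarrow> A $$ (i, j) = 0)"


section \<open>Matrix functions\<close>

text \<open>
  \<open>has_nth_deriv S f k D z\<close>: the function \<open>f\<close> with domain \<open>S\<close> has a \<open>k\<close>-th derivative at
  \<open>z\<close>, with value \<open>D\<close>. As usual this needs the derivative of order \<open>k - 1\<close> to exist (as \<open>g\<close>) at
  all points of \<open>S\<close> near \<open>z\<close>, including \<open>z\<close>. Derivatives are taken within \<open>S\<close>, so that both
  complex functions (\<open>S\<close> open) and functions of a real variable (\<open>S\<close> an interval) are covered;
  \<open>z\<close> has to be a limit point of \<open>S\<close>, since otherwise every number would be a derivative.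
\<close>

primrec has_nth_deriv ::
  "complex set \<Rightarrow> (complex \<Rightarrow> complex) \<Rightarrow> nat \<Rightarrow> complex \<Rightarrow> complex \<Rightarrow> bool" where
  "has_nth_deriv S f 0 D z \<longleftrightarrow> z \<in> S \<and> D = f z"
| "has_nth_deriv S f (Suc k) D z \<longleftrightarrow>
    z \<in> S \<and> at z within S \<noteq> bot \<and>
    (\<exists>g. (\<forall>\<^sub>F x in nhds z. x \<in> S \<longrightarrow> has_nth_deriv S f k (g x) x) \<and>
         (g has_field_derivative D) (at z within S))"

lemma has_nth_deriv_unique:
  assumes "has_nth_deriv S f k D z" "has_nth_deriv S f k D' z"
  shows "D = D'"
  using assms
proof (induction k arbitrary: z D D')
  case 0
  then show ?case by simp
next
  case (Suc k)
  from Suc.prems obtain g h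
    where z: "z \<in> S" "at z within S \<noteq> bot"
      and g: "\<forall>\<^sub>F x in nhds z. x \<in> S \<longrightarrow> has_nth_deriv S f k (g x) x"
        "(g has_field_derivative D) (at z within S)"
      and h: "\<forall>\<^sub>F x in nhds z. x \<in> S \<longrightarrow> has_nth_deriv S f k (h x) x"
        "(h has_field_derivative D') (at z within S)"
    by auto
  have eq: "\<forall>\<^sub>F x in nhds z. x \<in> S \<longrightarrow> g x = h x"
    using g(1) h(1) by eventually_elim (use Suc.IH in blast)
  then have "\<forall>\<^sub>F x in at z within S. g x = h x"
    by (auto simp: eventually_at_filter elim: eventually_mono)
  moreover have "g z = h z"
    using eventually_nhds_x_imp_x[OF eq] z(1) by blast
  ultimately have "(h has_field_derivative D) (at z within S)"
    using g(2) z(1) has_field_derivative_cong_eventually by blast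
  then have "((\<lambda>y. (h y - h z) / (y - z)) \<longlongrightarrow> D) (at z within S)"
    "((\<lambda>y. (h y - h z) / (y - z)) \<longlongrightarrow> D') (at z within S)"
    using h(2) by (simp_all add: has_field_derivative_iff)
  then show ?case
    using z(2) tendsto_unique by blast
qed

text \<open>
  The pairs \<open>(z, j)\<close> of an eigenvalue \<open>z\<close> and an order \<open>j\<close> that is smaller than the size of the
  largest Jordan block with eigenvalue \<open>z\<close>.
\<close>

definition spectral_orders :: "complex mat \<Rightarrow> (complex \<times> nat) set" where
  "spectral_orders A =
    {(z, j). \<exists>n_as k. jordan_nf A n_as \<and> (k, z) \<in> set n_as \<and> j < k}"

definition defined_on_spectrum :: "complex set \<Rightarrow> (complex \<Rightarrow> complex) \<Rightarrow> complex mat \<Rightarrow> bool" where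
  "defined_on_spectrum S f A \<longleftrightarrow> (\<forall>(z, j) \<in> spectral_orders A. \<exists>D. has_nth_deriv S f j D z)"

definition hermite_interpolates ::
  "complex set \<Rightarrow> (complex \<Rightarrow> complex) \<Rightarrow> complex mat \<Rightarrow> complex poly \<Rightarrow> bool" where
  "hermite_interpolates S f A p \<longleftrightarrow>
    (\<forall>(z, j) \<in> spectral_orders A. has_nth_deriv S f j (poly ((pderiv ^^ j) p) z) z)"

definition poly_of_mat :: "complex poly \<Rightarrow> complex mat \<Rightarrow> complex mat" where
  "poly_of_mat p A =
    mat (dim_row A) (dim_row A) (\<lambda>ij. \<Sum>k\<le>degree p. coeff p k * (A ^\<^sub>m k) $$ ij)"

text \<open>
  Any two polynomials that interpolate \<open>f\<close> on the spectrum of \<open>A\<close> differ by a multiple of the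
  minimal polynomial of \<open>A\<close>, so the value does not depend on the choice of \<open>p\<close>. It is
  meaningful only under \<^const>\<open>defined_on_spectrum\<close>, which guarantees that such a \<open>p\<close> exists.
\<close>

definition mat_fun :: "complex set \<Rightarrow> (complex \<Rightarrow> complex) \<Rightarrow> complex mat \<Rightarrow> complex mat" where
  "mat_fun S f A = poly_of_mat (SOME p. hermite_interpolates S f A p) A"


section \<open>Trace and probing estimate\<close>

definition mat_trace :: "'a :: comm_monoid_add mat \<Rightarrow> 'a" where
  "mat_trace F = (\<Sum>i < dim_row F. F $$ (i, i))"

definition band_col :: "nat \<Rightarrow> nat \<Rightarrow> nat \<Rightarrow> nat" where
  "band_col \<beta> d i = i mod (d * \<beta> + 1)"

definition probing_vec :: "nat \<Rightarrow> nat \<Rightarrow> nat \<Rightarrow> nat \<Rightarrow> complex vec" where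
  "probing_vec n \<beta> d l =
    finsum_vec TYPE(complex) n (unit_vec n) {i. i < n \<and> band_col \<beta> d i = l}"

definition probing_trace :: "nat \<Rightarrow> nat \<Rightarrow> complex mat \<Rightarrow> complex" where
  "probing_trace \<beta> d F =
    (\<Sum>l < d * \<beta> + 1.
      let v = probing_vec (dim_row F) \<beta> d l in conjugate v \<bullet> (F *\<^sub>v v))"

end

theory Submission
  imports Defs
begin

text \<open>
  Every edge of the graph of a \<open>\<beta>\<close>-banded matrix changes the index by at most \<open>\<beta>\<close>, so two
  distinct indices of the same colour, which differ by \<open>k (d \<beta> + 1)\<close> for some \<open>k \<ge> 1\<close>, have
  distance at least \<open>k d\<close>. The probing error is the sum of the entries at such pairs; each \<open>k\<close>
  occurs at most twice in a row, so each row contributes at most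
  \<open>2 C (q^d + q^(2 d) + \<dots>) = 2 C q^d / (1 - q^d)\<close>.
\<close>

text \<open>Triangle inequality, one arc at a time. The claim concerns connected arc lists rather
  than \<open>apath\<close>, because both conditions on \<open>p\<close> pass directly to its tail
  in the induction.\<close>

lemma banded_cas_diff_le:
  assumes "banded \<beta> A" "A \<in> carrier_mat n n"
    and "set p \<subseteq> arcs (mat_graph A)" "pre_digraph.cas (mat_graph A) i p j"
  shows "\<bar>int i - int j\<bar> \<le> int (\<beta> * length p)"
  using assms(3,4)
proof (induction p arbitrary: i)
  case Nil
  then show ?case by (simp add: pre_digraph.cas.simps)
next
  case (Cons e p)
  obtain a b where e: "e = (a, b)" by (cases e)
  from Cons.prems have "i = a" and cas: "pre_digraph.cas (mat_graph A) b p j"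
    and arc: "a < dim_row A" "b < dim_row A" "A $$ (a, b) \<noteq> 0"
    by (auto simp: e pre_digraph.cas.simps mat_graph_def)
  have "\<bar>int a - int b\<bar> \<le> int \<beta>"
    using arc assms(1,2) by (force simp: banded_def)
  moreover have "\<bar>int b - int j\<bar> \<le> int (\<beta> * length p)"
    using Cons.IH[OF _ cas] Cons.prems(1) by simp
  ultimately show ?case
    using \<open>i = a\<close> by (simp add: algebra_simps)
qed

text \<open>Powers of \<open>q\<close> decrease, and the value 0 at \<infinity> (unreachable vertex)
  lies below all of them.\<close>

lemma pow_enat_le_power:
  assumes "0 \<le> q" "q \<le> 1" "enat m \<le> k"
  shows "pow_enat q k \<le> q ^ m"
  using assms by (cases k) (auto simp: pow_enat_def intro: power_decreasing)

lemma mat_graph_dist_ge: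
  assumes "banded \<beta> A" "A \<in> carrier_mat n n"
    and "k * (d * \<beta> + 1) \<le> nat \<bar>int i - int j\<bar>"
  shows "enat (k * d) \<le> mat_graph_dist A i j"
  unfolding mat_graph_dist_def
proof (rule INF_greatest)
  fix p assume "p \<in> {p. pre_digraph.apath (mat_graph A) i p j}"
  then have "set p \<subseteq> arcs (mat_graph A)" "pre_digraph.cas (mat_graph A) i p j"
    by (auto simp: pre_digraph.apath_def pre_digraph.awalk_def)
  from banded_cas_diff_le[OF assms(1,2) this]
  have "nat \<bar>int i - int j\<bar> \<le> \<beta> * length p" by linarith
  with assms(3) have le: "k * d * \<beta> + k \<le> length p * \<beta>" by (simp add: algebra_simps)
  have "k * d \<le> length p"
  proof (cases "k = 0")
    case False
    \<comment> \<open>The summand \<open>k\<close>, which stems from the \<open>+ 1\<close> in the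
      number of colours, makes the inequality strict, so that \<beta> can be cancelled. For \<beta>
      = 0 it is contradictory: no path joins such indices.\<close>
    with le have "k * d * \<beta> < length p * \<beta>" by linarith
    then show ?thesis by simp
  qed simp
  then show "enat (k * d) \<le> enat (length p)" by simp
qed

text \<open>Adding the missing exponent 0 contributes 1 and still gives a partial sum of the full
  series, so the bound is 1 / (1 - x) - 1.\<close>

lemma sum_power_le_geometric:
  fixes x :: real
  assumes "0 \<le> x" "x < 1" "finite K" "0 \<notin> K"
  shows "(\<Sum>k\<in>K. x ^ k) \<le> x / (1 - x)"
proof -
  have "summable (\<lambda>k. x ^ k)" using assms by (intro summable_geometric) simp
  then have "(\<Sum>k\<in>insert 0 K. x ^ k) \<le> (\<Sum>k. x ^ k)"
    using assms by (intro sum_le_suminf) auto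
  then have "1 + (\<Sum>k\<in>K. x ^ k) \<le> 1 / (1 - x)"
    using assms by (simp add: suminf_geometric)
  then show ?thesis using assms by (simp add: field_simps)
qed

lemma sum_same_residue_power_le:
  fixes x :: real and i m :: nat
  assumes "0 \<le> x" "x < 1" "m > 0" "finite J"
    and res: "\<And>j. j \<in> J \<Longrightarrow> j \<noteq> i \<and> j mod m = i mod m"
  shows "(\<Sum>j\<in>J. x ^ (nat \<bar>int i - int j\<bar> div m)) \<le> 2 * x / (1 - x)"
proof -
  let ?k = "\<lambda>j. nat \<bar>int i - int j\<bar> div m"
  \<comment> \<open>Within a residue class the division is exact, so the exponent determines the
    distance to \<open>i\<close> and is positive.\<close>
  have k: "int m * int (?k j) = \<bar>int i - int j\<bar>" if "j \<in> J" for j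
  proof -
    have "int m dvd \<bar>int i - int j\<bar>"
      using res[OF that] by (metis dvd_abs_iff mod_eq_dvd_iff of_nat_mod)
    then have "m dvd nat \<bar>int i - int j\<bar>" by (simp flip: int_dvd_int_iff)
    then have "m * ?k j = nat \<bar>int i - int j\<bar>" by simp
    then show ?thesis by (metis int_nat_eq abs_ge_zero of_nat_mult)
  qed
  \<comment> \<open>To be used for the indices on one side of \<open>i\<close>, where the distance
    determines \<open>j\<close> and no exponent repeats. The two sides give the factor 2.\<close>
  have half: "(\<Sum>j\<in>H. x ^ ?k j) \<le> x / (1 - x)"
    if H: "H \<subseteq> J" and inj: "inj_on (\<lambda>j. \<bar>int i - int j\<bar>) H" for H
  proof -
    have "inj_on ?k H"
    proof (rule inj_onI)
      fix a b assume ab: "a \<in> H" "b \<in> H" "?k a = ?k b"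
      then have "\<bar>int i - int a\<bar> = \<bar>int i - int b\<bar>" using k H by (metis subsetD)
      with inj ab show "a = b" by (auto dest: inj_onD)
    qed
    then have "(\<Sum>j\<in>H. x ^ ?k j) = (\<Sum>k\<in>?k ` H. x ^ k)" by (simp add: sum.reindex)
    also have "0 \<notin> ?k ` H"
    proof
      assume "0 \<in> ?k ` H"
      then obtain j where "j \<in> H" "?k j = 0" by auto
      with k[of j] res[of j] H show False by auto
    qed
    then have "(\<Sum>k\<in>?k ` H. x ^ k) \<le> x / (1 - x)"
      using assms finite_subset[OF H] by (intro sum_power_le_geometric) auto
    finally show ?thesis .
  qed
  have "J = (J \<inter> {..<i}) \<union> (J \<inter> {i<..})" using res by force
  then have "(\<Sum>j\<in>J. x ^ ?k j) = (\<Sum>j\<in>(J \<inter> {..<i}) \<union> (J \<inter> {i<..}). x ^ ?k j)" by simp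
  also have "\<dots> = (\<Sum>j\<in>J \<inter> {..<i}. x ^ ?k j) + (\<Sum>j\<in>J \<inter> {i<..}. x ^ ?k j)"
    using assms by (intro sum.union_disjoint) auto
  also have "\<dots> \<le> x / (1 - x) + x / (1 - x)"
    by (intro add_mono half) (auto simp: inj_on_def)
  finally show ?thesis by simp
qed

lemma probing_vec_carrier: "probing_vec n \<beta> d l \<in> carrier_vec n"
  unfolding probing_vec_def by (rule finsum_vec_closed) auto

lemma probing_vec_index:
  assumes "i < n"
  shows "probing_vec n \<beta> d l $ i = (if band_col \<beta> d i = l then 1 else 0)"
proof -
  have "probing_vec n \<beta> d l $ i
      = (\<Sum>k | k < n \<and> band_col \<beta> d k = l. unit_vec n k $ i)"
    unfolding probing_vec_def using assms by (intro index_finsum_vec) auto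
  also have "\<dots> = (\<Sum>k | k < n \<and> band_col \<beta> d k = l. if k = i then 1 else 0)"
    using assms by (intro sum.cong) auto
  finally show ?thesis using assms by simp
qed

text \<open>Probing vectors are 0/1 indicators of colour classes, so each quadratic form adds up the
  entries whose row and column both have colour \<open>l\<close>. Each row has exactly one colour,
  so it is counted once.\<close>

lemma probing_trace_eq:
  assumes F: "F \<in> carrier_mat n n"
  shows "probing_trace \<beta> d F =
    (\<Sum>i<n. \<Sum>j | j < n \<and> band_col \<beta> d j = band_col \<beta> d i. F $$ (i, j))"
proof -
  let ?c = "band_col \<beta> d" and ?v = "probing_vec n \<beta> d"
  have quad: "conjugate (?v l) \<bullet> (F *\<^sub>v ?v l) =
      (\<Sum>i<n. if ?c i = l then \<Sum>j | j < n \<and> ?c j = l. F $$ (i, j) else 0)" for l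
  proof -
    have Fv: "(F *\<^sub>v ?v l) $ i = (\<Sum>j | j < n \<and> ?c j = l. F $$ (i, j))" if "i < n" for i
    proof -
      have "(F *\<^sub>v ?v l) $ i = (\<Sum>j<n. if ?c j = l then F $$ (i, j) else 0)"
        using F that probing_vec_carrier[of n \<beta> d l]
        by (auto simp: scalar_prod_def probing_vec_index atLeast0LessThan intro!: sum.cong)
      also have "\<dots> = (\<Sum>j | j < n \<and> ?c j = l. F $$ (i, j))"
        by (subst sum.inter_filter[symmetric]) auto
      finally show ?thesis .
    qed
    \<comment> \<open>\<open>index_mult_mat_vec\<close> is switched off so that entries of the
      product are rewritten by \<open>Fv\<close>.\<close>
    show ?thesis
      using F probing_vec_carrier[of n \<beta> d l]
      by (auto simp: scalar_prod_def Fv probing_vec_index atLeast0LessThan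
          simp del: index_mult_mat_vec intro!: sum.cong)
  qed
  have "probing_trace \<beta> d F =
      (\<Sum>l<d * \<beta> + 1. \<Sum>i<n. if ?c i = l then \<Sum>j | j < n \<and> ?c j = l. F $$ (i, j) else 0)"
    using F by (simp add: probing_trace_def Let_def quad)
  also have "\<dots> =
      (\<Sum>i<n. \<Sum>l<d * \<beta> + 1. if ?c i = l then \<Sum>j | j < n \<and> ?c j = l. F $$ (i, j) else 0)"
    by (rule sum.swap)
  also have "\<dots> = (\<Sum>i<n. \<Sum>j | j < n \<and> ?c j = ?c i. F $$ (i, j))"
  proof (rule sum.cong[OF refl])
    fix i
    \<comment> \<open>The colour lies in the range of summation, so the sum over \<open>l\<close>
      collapses to its single term \<open>l = ?c i\<close>.\<close>
    have "?c i \<in> {..<d * \<beta> + 1}"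
      unfolding band_col_def lessThan_iff by (rule mod_less_divisor) simp
    then show "(\<Sum>l<d * \<beta> + 1. if ?c i = l then \<Sum>j | j < n \<and> ?c j = l. F $$ (i, j) else 0)
        = (\<Sum>j | j < n \<and> ?c j = ?c i. F $$ (i, j))"
      by (subst sum.delta') auto
  qed
  finally show ?thesis .
qed

text \<open>Every index shares its own colour, so the diagonal cancels and only off-diagonal entries
  of equal colour remain. This separates the algebra of probing from the decay estimate.\<close>

lemma probing_error_le:
  assumes F: "F \<in> carrier_mat n n"
    and row: "\<And>i. i < n \<Longrightarrow>
      (\<Sum>j | j < n \<and> j \<noteq> i \<and> band_col \<beta> d j = band_col \<beta> d i. cmod (F $$ (i, j))) \<le> B"
  shows "cmod (mat_trace F - probing_trace \<beta> d F) \<le> real n * B"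
proof -
  let ?J = "\<lambda>i. {j. j < n \<and> j \<noteq> i \<and> band_col \<beta> d j = band_col \<beta> d i}"
  have "(\<Sum>j | j < n \<and> band_col \<beta> d j = band_col \<beta> d i. F $$ (i, j))
      = F $$ (i, i) + (\<Sum>j\<in>?J i. F $$ (i, j))" if "i < n" for i
  proof -
    have "{j. j < n \<and> band_col \<beta> d j = band_col \<beta> d i} = insert i (?J i)" using that by auto
    then show ?thesis by simp
  qed
  then have "probing_trace \<beta> d F = mat_trace F + (\<Sum>i<n. \<Sum>j\<in>?J i. F $$ (i, j))"
    using F by (simp add: probing_trace_eq[OF F] mat_trace_def sum.distrib)
  then have "cmod (mat_trace F - probing_trace \<beta> d F) = cmod (\<Sum>i<n. \<Sum>j\<in>?J i. F $$ (i, j))"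
    by (simp add: norm_minus_commute)
  also have "\<dots> \<le> (\<Sum>i<n. \<Sum>j\<in>?J i. cmod (F $$ (i, j)))"
    by (intro sum_norm_le norm_sum)
  also have "\<dots> \<le> (\<Sum>i<n. B)"
    by (intro sum_mono row) simp
  finally show ?thesis by simp
qed

theorem theorem4p1:
  fixes A :: "complex mat" and f :: "complex \<Rightarrow> complex" and S :: "complex set"
    and C q \<epsilon> :: real and n \<beta> d :: nat
  assumes "A \<in> carrier_mat n n"
    and "banded \<beta> A"
    and "defined_on_spectrum S f A"
    and "C > 0" and "0 \<le> q" and "q < 1"
    and "\<And>i j. i < n \<Longrightarrow> j < n \<Longrightarrow>
           cmod (mat_fun S f A $$ (i, j)) \<le> C * pow_enat q (mat_graph_dist A i j)"
    and "d > 0"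
    and "\<epsilon> = C * q ^ d"
  shows "cmod (mat_trace (mat_fun S f A) - probing_trace \<beta> d (mat_fun S f A))
           \<le> \<epsilon> * (2 * real n / (1 - q ^ d))"
proof -
  let ?F = "mat_fun S f A" and ?m = "d * \<beta> + 1"
  have F: "?F \<in> carrier_mat n n"
    using assms(1) by (simp add: mat_fun_def poly_of_mat_def)
  \<comment> \<open>Positivity of \<open>d\<close> enters here: for \<open>d = 0\<close> the ratio
    would be 1.\<close>
  have x: "0 \<le> q ^ d" "q ^ d < 1"
    using assms(5,6,8) by (auto simp: power_less_one_iff)
  have row: "(\<Sum>j | j < n \<and> j \<noteq> i \<and> band_col \<beta> d j = band_col \<beta> d i. cmod (?F $$ (i, j)))
      \<le> C * (2 * q ^ d / (1 - q ^ d))" if "i < n" for i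
  proof -
    let ?J = "{j. j < n \<and> j \<noteq> i \<and> band_col \<beta> d j = band_col \<beta> d i}"
    let ?k = "\<lambda>j. nat \<bar>int i - int j\<bar> div ?m"
    \<comment> \<open>Rounding down keeps \<open>?k j * ?m\<close> at most the index difference, so
      this bound holds in every column; colours enter only in the geometric sum.\<close>
    have "cmod (?F $$ (i, j)) \<le> C * (q ^ d) ^ ?k j" if "j < n" for j
    proof -
      have "enat (?k j * d) \<le> mat_graph_dist A i j"
        by (rule mat_graph_dist_ge[OF assms(2,1)]) (rule div_times_less_eq_dividend)
      then have "pow_enat q (mat_graph_dist A i j) \<le> q ^ (?k j * d)"
        using assms(5,6) by (intro pow_enat_le_power) auto
      also have "\<dots> = (q ^ d) ^ ?k j" by (simp add: mult.commute flip: power_mult)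
      finally have "C * pow_enat q (mat_graph_dist A i j) \<le> C * (q ^ d) ^ ?k j"
        using assms(4) by simp
      with assms(7)[OF \<open>i < n\<close> that] show ?thesis by linarith
    qed
    then have "(\<Sum>j\<in>?J. cmod (?F $$ (i, j))) \<le> (\<Sum>j\<in>?J. C * (q ^ d) ^ ?k j)"
      by (intro sum_mono) auto
    also have "\<dots> = C * (\<Sum>j\<in>?J. (q ^ d) ^ ?k j)" by (simp add: sum_distrib_left)
    also have "(\<Sum>j\<in>?J. (q ^ d) ^ ?k j) \<le> 2 * q ^ d / (1 - q ^ d)"
      using x by (intro sum_same_residue_power_le) (auto simp: band_col_def)
    finally show ?thesis using assms(4) by simp
  qed
  show ?thesis
    using probing_error_le[OF F row] by (simp add: assms(9) mult_ac)
qed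

end
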